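(* Let $D$ be a $k$-partite tournament with $k$-partition $(V_1,\ldots,V_k)$ and ordered strong components $Q_1,\ldots,Q_s$ for some integers $k\ge 2$ and $s\ge 2$, and let $Q_t$ be the last nontrivial component of $D$, with $\kappa(Q_t)=2$ and $t<s$. Assume that the partite sets are labeled so that $V_i\cap V(Q_t)=U_i^{(t)}$ for $i=1,2$, where $U_1^{(t)},U_2^{(t)}$ are the sets of imprimitivity of $Q_t$. Let $r$ be the head completing index of $D$, and let $A_1=V_1\cap\bigcup_{i=r+1}^{t}V(Q_i)$ and $A_2=V_2\cap\bigcup_{i=r+1}^{t}V(Q_i)$. Then the graph sequence $\{C^m(D)\}_{m=1}^{\infty}$ converges to a graph isomorphic to $$\begin{cases}\bigl(K[D_{1\sim r}]\vee (K[A_1]\cup K[A_2])\bigr)\cup I[D_{t+1\sim s}], & \text{if } V(D_{t+1\sim s})\subseteq V_1\cup V_2;\\ K[D_{1\sim t}]\cup I[D_{t+1\sim s}], & \text{otherwise.}\end{cases}$$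
   Context: All digraphs are finite with simple underlying graph. For a positive integer $m$, the $m$-step competition graph $C^m(D)$ of a digraph $D$ is the simple graph with vertex set $V(D)$ in which two distinct vertices $u,v$ are adjacent iff there is a vertex $w$ such that there are directed walks of length exactly $m$ from $u$ to $w$ and from $v$ to $w$. The sequence $\{C^m(D)\}_{m=1}^\infty$ converges to a graph $G$ if $C^m(D)=G$ for all sufficiently large $m$. A $k$-partite tournament is an orientation of a complete $k$-partite graph; its $k$-partition $(V_1,\dots,V_k)$ consists of its (nonempty) partite sets. Ordered strong components of $D$ are its strong components arranged as $Q_1,\ldots,Q_s$ so that there is no arc from $Q_i$ to $Q_j$ whenever $i>j$. A strong component is trivial if it has exactly one vertex and nontrivial otherwise. The last nontrivial component is the nontrivial $Q_t$ such that $Q_i$ is trivial for every $t<i\le s$. $D_{\alpha\sim\beta}$ denotes the subdigraph induced by $\bigcup_{i=\alpha}^{\beta}V(Q_i)$ if $\alpha\le\beta$, and is ignored (empty) if $\alpha>\beta$. For a nontrivial strongly connected digraph $Q$, the index of imprimitivity $\kappa(Q)$ is the greatest common divisor of the lengths of its closed directed walks. The sets of imprimitivity of $Q$ are the nonempty sets $U_1,\dots,U_{\kappa(Q)}$ partitioning $V(Q)$ such that each arc of $Q$ goes from $U_i$ to $U_{i+1}$ for some $i$ (with $U_{\kappa(Q)+1}=U_1$); those of $Q_t$ are written $U_i^{(t)}$. It is known that if $\kappa(Q_t)=2$ then $Q_t$ is a bipartite tournament whose partite sets are its sets of imprimitivity, so the labeling assumed in the claim is always possible. A partite set of $Q_i$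 is a nonempty intersection of $V(Q_i)$ with a partite set of $D$. A vertex set $X$ is partite-related to a vertex set $Y$ if $X$ and $Y$ are both contained in one partite set of $D$. Head completing index of $D$: if there is an integer $r$ with $1\le r<t$ such that some partite set of $Q_r$ is not partite-related to any partite set of $Q_t$, the head completing index is the largest such $r$; otherwise it equals $0$. For vertex-disjoint graphs, $\cup$ denotes disjoint union and $\vee$ denotes join (the union together with all edges between the two graphs). For a vertex set $Z$, $K[Z]$ and $I[Z]$ are the complete graph and the edgeless graph on $Z$; for a digraph $H$, $K[H]=K[V(H)]$ and $I[H]=I[V(H)]$. *)

theory Defs
  imports
    Main
    "HOL-Library.Disjoint_Sets"
    "Graph_Theory.Digraph_Component"
    "Graph_Theory.Digraph_Isomorphism"
begin

text \<open>
  As in the Graph_Theory entry, a simple undirected graph is represented by a symmetric, loopfree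
  digraph; here always a \<^typ>\<open>'a pair_pre_digraph\<close>, whose arcs are ordered pairs of vertices.
\<close>

section \<open>Simple graphs\<close>

definition complete_graph_on :: "'a set \<Rightarrow> 'a pair_pre_digraph" where
  "complete_graph_on Z = \<lparr> pverts = Z, parcs = {(u, v). u \<in> Z \<and> v \<in> Z \<and> u \<noteq> v} \<rparr>"

definition edgeless_graph_on :: "'a set \<Rightarrow> 'a pair_pre_digraph" where
  "edgeless_graph_on Z = \<lparr> pverts = Z, parcs = {} \<rparr>"

text \<open>The next two operations are meant for vertex-disjoint graphs only.\<close>

definition graph_union :: "'a pair_pre_digraph \<Rightarrow> 'a pair_pre_digraph \<Rightarrow> 'a pair_pre_digraph" where
  "graph_union G H = \<lparr> pverts = pverts G \<union> pverts H, parcs = parcs G \<union> parcs H \<rparr>"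

definition graph_join :: "'a pair_pre_digraph \<Rightarrow> 'a pair_pre_digraph \<Rightarrow> 'a pair_pre_digraph" where
  "graph_join G H = \<lparr> pverts = pverts G \<union> pverts H,
     parcs = parcs G \<union> parcs H \<union> pverts G \<times> pverts H \<union> pverts H \<times> pverts G \<rparr>"

definition complete_multipartite_graph :: "nat \<Rightarrow> (nat \<Rightarrow> 'a set) \<Rightarrow> 'a pair_pre_digraph" where
  "complete_multipartite_graph k V = \<lparr> pverts = (\<Union>i\<in>{1..k}. V i),
     parcs = {(u, v). \<exists>i\<in>{1..k}. \<exists>j\<in>{1..k}. i \<noteq> j \<and> u \<in> V i \<and> v \<in> V j} \<rparr>"


section \<open>Competition graphs\<close>

definition competition_graph :: "nat \<Rightarrow> ('a, 'b) pre_digraph \<Rightarrow> 'a pair_pre_digraph" where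
  "competition_graph m D = \<lparr> pverts = verts D,
     parcs = {(u, v). u \<in> verts D \<and> v \<in> verts D \<and> u \<noteq> v \<and>
       (\<exists>w p q. pre_digraph.awalk D u p w \<and> length p = m \<and>
                pre_digraph.awalk D v q w \<and> length q = m)} \<rparr>"

definition graph_seq_converges :: "(nat \<Rightarrow> 'a pair_pre_digraph) \<Rightarrow> 'a pair_pre_digraph \<Rightarrow> bool" where
  "graph_seq_converges C G \<longleftrightarrow> (\<forall>\<^sub>F m in sequentially. C m = G)"


section \<open>Multipartite tournaments\<close>

definition orientation_of :: "('a, 'b) pre_digraph \<Rightarrow> 'a pair_pre_digraph \<Rightarrow> bool" where
  "orientation_of D G \<longleftrightarrow> digraph D \<and> verts D = pverts G \<and>
     arcs_ends D \<union> (arcs_ends D)\<inverse> = parcs G \<and> arcs_ends D \<inter> (arcs_ends D)\<inverse> = {}"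

definition multipartite_tournament ::
    "nat \<Rightarrow> (nat \<Rightarrow> 'a set) \<Rightarrow> ('a, 'b) pre_digraph \<Rightarrow> bool" where
  "multipartite_tournament k V D \<longleftrightarrow>
     (\<forall>i\<in>{1..k}. V i \<noteq> {}) \<and> disjoint_family_on V {1..k} \<and>
     orientation_of D (complete_multipartite_graph k V)"


section \<open>Strong components and imprimitivity\<close>

definition ordered_strong_components ::
    "('a, 'b) pre_digraph \<Rightarrow> nat \<Rightarrow> (nat \<Rightarrow> ('a, 'b) pre_digraph) \<Rightarrow> bool" where
  "ordered_strong_components D s Q \<longleftrightarrow>
     bij_betw Q {1..s} (pre_digraph.sccs D) \<and>
     (\<forall>i\<in>{1..s}. \<forall>j\<in>{1..s}. i > j \<longrightarrow>
        (\<forall>u\<in>verts (Q i). \<forall>v\<in>verts (Q j). \<not> u \<rightarrow>\<^bsub>D\<^esub> v))"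

definition trivial_component :: "('a, 'b) pre_digraph \<Rightarrow> bool" where
  "trivial_component H \<longleftrightarrow> card (verts H) = 1"

definition last_nontrivial_component :: "nat \<Rightarrow> (nat \<Rightarrow> ('a, 'b) pre_digraph) \<Rightarrow> nat \<Rightarrow> bool" where
  "last_nontrivial_component s Q t \<longleftrightarrow>
     t \<in> {1..s} \<and> \<not> trivial_component (Q t) \<and> (\<forall>i. t < i \<and> i \<le> s \<longrightarrow> trivial_component (Q i))"

text \<open>The subdigraph $D_{a \sim b}$; it has no vertices if $a > b$.\<close>

definition component_range ::
    "('a, 'b) pre_digraph \<Rightarrow> (nat \<Rightarrow> ('a, 'b) pre_digraph) \<Rightarrow> nat \<Rightarrow> nat \<Rightarrow> ('a, 'b) pre_digraph" where
  "component_range D Q a b = D \<restriction> (\<Union>i\<in>{a..b}. verts (Q i))"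

definition imprimitivity_index :: "('a, 'b) pre_digraph \<Rightarrow> nat" where
  "imprimitivity_index H = Gcd {length p | u p. pre_digraph.awalk H u p u \<and> p \<noteq> []}"

definition imprimitivity_sets :: "('a, 'b) pre_digraph \<Rightarrow> (nat \<Rightarrow> 'a set) \<Rightarrow> bool" where
  "imprimitivity_sets H U \<longleftrightarrow> (let \<kappa> = imprimitivity_index H in
     (\<forall>i\<in>{1..\<kappa>}. U i \<noteq> {}) \<and> disjoint_family_on U {1..\<kappa>} \<and> (\<Union>i\<in>{1..\<kappa>}. U i) = verts H \<and>
     (\<forall>a\<in>arcs H. \<exists>i\<in>{1..\<kappa>}.
        tail H a \<in> U i \<and> head H a \<in> U (if i = \<kappa> then 1 else i + 1)))"


section \<open>Head completing index\<close>

definition partite_sets_of_component ::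
    "nat \<Rightarrow> (nat \<Rightarrow> 'a set) \<Rightarrow> ('a, 'b) pre_digraph \<Rightarrow> 'a set set" where
  "partite_sets_of_component k V H =
     {verts H \<inter> V j | j. j \<in> {1..k} \<and> verts H \<inter> V j \<noteq> {}}"

definition partite_related :: "nat \<Rightarrow> (nat \<Rightarrow> 'a set) \<Rightarrow> 'a set \<Rightarrow> 'a set \<Rightarrow> bool" where
  "partite_related k V X Y \<longleftrightarrow> (\<exists>j\<in>{1..k}. X \<subseteq> V j \<and> Y \<subseteq> V j)"

definition head_completing_index ::
    "nat \<Rightarrow> (nat \<Rightarrow> 'a set) \<Rightarrow> (nat \<Rightarrow> ('a, 'b) pre_digraph) \<Rightarrow> nat \<Rightarrow> nat" where
  "head_completing_index k V Q t =
     (let R = {r. 1 \<le> r \<and> r < t \<and>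
                  (\<exists>X \<in> partite_sets_of_component k V (Q r).
                     \<forall>Y \<in> partite_sets_of_component k V (Q t). \<not> partite_related k V X Y)}
      in if R = {} then 0 else Max R)"

end

theory Submission
  imports Defs
begin

text \<open>
  Since $Q_t$ has period two, any sufficiently long walk length of the right parity is realised
  between two given vertices of $Q_t$. Fix $y_1 \in U_1$ and $y_2 \in U_2$. Every vertex of
  $D_{1 \sim t}$ then has, for all large $n$, an $n$-walk to one of $y_1, y_2$, alternating with the
  parity of $n$; a vertex outside $V_1$ or $V_2$ can jump directly into $U_1$ or $U_2$, respectively,
  which fixes the phase of the alternation. Vertices of $D_{1 \sim r}$ have both phases, because
  $Q_r$ contains a vertex outside $V_1 \cup V_2$. Equal phases give adjacency in $C^m(D)$.
  If the tail $D_{t+1 \sim s}$ lies in $V_1 \cup V_2$, then everything after $Q_r$ is bipartite and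
  closed under arcs, so opposite phases never meet; otherwise a tail vertex outside
  $V_1 \cup V_2$ is a common target of both phases. Walks from the acyclic tail have bounded length.
\<close>

section \<open>Additively closed sets of natural numbers\<close>

text \<open>
  The least positive difference $d$ of elements of $S$ divides every element of $S$: otherwise the
  remainder of an element modulo $d$ would be a smaller difference. So $d$ is the gcd, and combinations
  of two elements $b$ and $b + d$ reach all large multiples of $d$.
\<close>

lemma eventually_multiple_in_additive_set:
  fixes S :: "nat set"
  assumes add: "\<And>a b. a \<in> S \<Longrightarrow> b \<in> S \<Longrightarrow> a + b \<in> S" and pos: "Gcd S > 0"
  shows "\<forall>\<^sub>F n in sequentially. Gcd S dvd n \<longrightarrow> n \<in> S"
proof -
  \<comment> \<open>\<open>P d\<close> makes \<open>d\<close> a positive difference of two elements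
    of \<open>S\<close>, the smaller one positive. That positivity later gives \<open>c > 0\<close>
    in \<open>b = d * c\<close>.\<close>
  define P where "P d \<longleftrightarrow> d > 0 \<and> (\<exists>x\<in>S. x > 0 \<and> x + d \<in> S)" for d
  define d where "d = (LEAST d. P d)"
  have mult: "m * a \<in> S" if "a \<in> S" "m > 0" for m a
    using that(2)
  proof (induction m rule: nat_induct_non_zero)
    case 1
    then show ?case using that by simp
  next
    case (Suc m)
    then show ?case using add[OF that(1) Suc.IH] by simp
  qed
  have self: "P a" if "a \<in> S" "a > 0" for a
    using that add[OF that(1) that(1)] unfolding P_def by blast
  have "\<exists>a\<in>S. a > 0"
  proof (rule ccontr)
    assume "\<not> ?thesis"
    then have "S \<subseteq> {0}" by auto
    then have "Gcd S = 0" by (simp only: Gcd_0_iff)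
    with pos show False by simp
  qed
  then have Pd: "P d"
    unfolding d_def using self by (blast intro: LeastI)
  have least: "d \<le> e" if "P e" for e
    unfolding d_def using that by (rule Least_le)
  from Pd obtain b where b: "b \<in> S" "b > 0" "b + d \<in> S" and "d > 0"
    unfolding P_def by blast
  have "d dvd x" if x: "x \<in> S" for x
  proof (rule ccontr)
    assume "\<not> d dvd x"
    then have \<rho>: "x mod d > 0" by (simp add: dvd_eq_mod_eq_0)
    have "P (x mod d)"
    proof (cases "x div d = 0")
      case True
      then have "x mod d = x"
        using \<open>d > 0\<close> by (simp add: div_eq_0_iff)
      then show ?thesis using self[OF x] \<rho> by simp
    next
      case False
      \<comment> \<open>Adding \<open>x div d\<close> copies of \<open>b\<close> to \<open>x\<close>
        turns each \<open>d\<close> in the quotient part into \<open>b + d\<close>. Both sides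
        without the remainder lie in \<open>S\<close>, so the remainder is a difference of
        elements.\<close>
      have "x div d * (b + d) + x mod d = x + x div d * b"
        using div_mult_mod_eq[of x d] by (simp add: distrib_left)
      moreover have q: "x div d > 0" using False by simp
      have "x + x div d * b \<in> S" by (rule add[OF x mult[OF b(1) q]])
      moreover have "x div d * (b + d) \<in> S" by (rule mult[OF b(3) q])
      moreover have "x div d * (b + d) > 0" using q b(2) by simp
      ultimately show ?thesis
        unfolding P_def using \<rho> by (intro conjI bexI[where x = "x div d * (b + d)"]) simp_all
    qed
    from least[OF this] show False
      using \<open>d > 0\<close> by (meson mod_less_divisor not_le)
  qed
  then have "d dvd Gcd S" by (rule Gcd_greatest)
  moreover have "Gcd S dvd d"
    using Gcd_dvd[OF b(1)] Gcd_dvd[OF b(3)] by (simp only: dvd_add_right_iff)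
  ultimately have d: "d = Gcd S" by (rule dvd_antisym)
  obtain c where c: "b = d * c"
    using Gcd_dvd[OF b(1)] unfolding d[symmetric] by (elim dvdE)
  \<comment> \<open>Write \<open>n = d * m\<close> and \<open>b = d * c\<close>. Since
    \<open>m \<ge> c * c\<close>, the quotient \<open>m div c\<close> exceeds the remainder
    \<open>m mod c\<close> by some \<open>e > 0\<close>, and \<open>n\<close> is the sum of
    \<open>e\<close> copies of \<open>b\<close> and \<open>m mod c\<close> copies of
    \<open>b + d\<close>.\<close>
  have "n \<in> S" if n: "n \<ge> d * (c * c)" "Gcd S dvd n" for n
  proof -
    obtain m where m: "n = d * m" using n(2) unfolding d[symmetric] by (elim dvdE)
    have "c > 0" using b(2) c by simp
    have "c * c \<le> m" using n(1) m \<open>d > 0\<close> by simp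
    then have "c \<le> m div c" using \<open>c > 0\<close> by (simp add: less_eq_div_iff_mult_less_eq)
    moreover have "m mod c < c" using \<open>c > 0\<close> by simp
    ultimately have "m mod c < m div c" by simp
    then obtain e where e: "m div c = m mod c + e" "e > 0"
      using less_imp_add_positive by metis
    have "m = (m mod c + e) * c + m mod c"
      using div_mult_mod_eq[of m c] unfolding e(1) by simp
    then have "n = d * ((m mod c + e) * c + m mod c)"
      using m by simp
    then have n_eq: "n = e * b + (m mod c) * (b + d)"
      using c by (simp add: algebra_simps)
    show ?thesis
    proof (cases "m mod c = 0")
      case True
      then show ?thesis using n_eq mult[OF b(1) e(2)] by simp
    next
      case False
      then have "m mod c > 0" by simp
      then show ?thesis unfolding n_eq by (rule add[OF mult[OF b(1) e(2)] mult[OF b(3)]])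
    qed
  qed
  then show ?thesis unfolding eventually_sequentially by blast
qed

section \<open>Walks of prescribed length\<close>

context wf_digraph
begin

definition has_walk :: "nat \<Rightarrow> 'a \<Rightarrow> 'a \<Rightarrow> bool" where
  "has_walk n u w \<longleftrightarrow> (\<exists>p. awalk u p w \<and> length p = n)"

lemma has_walk_0 [simp]: "has_walk 0 u w \<longleftrightarrow> u = w \<and> u \<in> verts G"
  by (auto simp: has_walk_def awalk_Nil_iff)

lemma has_walk_Suc: "has_walk (Suc n) u w \<longleftrightarrow> (\<exists>v. u \<rightarrow> v \<and> has_walk n v w)"
proof
  assume "has_walk (Suc n) u w"
  then show "\<exists>v. u \<rightarrow> v \<and> has_walk n v w"
    unfolding has_walk_def length_Suc_conv
    by (auto simp: awalk_Cons_iff) (metis in_arcs_imp_in_arcs_ends)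
next
  assume "\<exists>v. u \<rightarrow> v \<and> has_walk n v w"
  then obtain v p where "u \<rightarrow> v" "awalk v p w" "length p = n"
    by (auto simp: has_walk_def)
  then obtain e where "e \<in> arcs G" "tail G e = u" "head G e = v" by blast
  then have "awalk u (e # p) w" "length (e # p) = Suc n"
    using \<open>awalk v p w\<close> \<open>length p = n\<close> by (auto simp: awalk_Cons_iff)
  then show "has_walk (Suc n) u w" unfolding has_walk_def by blast
qed

lemma has_walk_trans: "has_walk m u v \<Longrightarrow> has_walk n v w \<Longrightarrow> has_walk (m + n) u w"
  unfolding has_walk_def by (metis awalk_appendI length_append)

lemma has_walk_adj: "u \<rightarrow> v \<Longrightarrow> has_walk 1 u v"
  by (auto simp: has_walk_Suc adj_in_verts)

lemma reachable_has_walk: "u \<rightarrow>\<^sup>* v \<Longrightarrow> \<exists>n. has_walk n u v"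
  by (auto simp: reachable_awalk has_walk_def)

lemma has_walk_subgraph:
  assumes "subgraph H G" "wf_digraph.has_walk H n u v"
  shows "has_walk n u v"
  using assms subgraph_awalk_imp_awalk
  by (metis has_walk_def subgraphE wf_digraph.has_walk_def)

text \<open>Induction on the length: \<open>R\<close> is closed under arcs, and membership in
  \<open>A\<close> is a 2-colouring of \<open>R\<close> that flips along each arc. It serves twice,
  inside \<open>Q t\<close> and for the components after \<open>Q r\<close>.\<close>

lemma has_walk_parity:
  assumes step: "\<And>u v. u \<in> R \<Longrightarrow> u \<rightarrow> v \<Longrightarrow> v \<in> R \<and> (v \<in> A \<longleftrightarrow> u \<notin> A)"
    and "has_walk n u w" "u \<in> R"
  shows "w \<in> R \<and> (even n \<longleftrightarrow> (u \<in> A \<longleftrightarrow> w \<in> A))"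
  using assms(2,3)
proof (induction n arbitrary: u)
  case (Suc n)
  then show ?case unfolding has_walk_Suc using step by (metis even_Suc)
qed auto

text \<open>The gcd of closed walk lengths at the single vertex \<open>u\<close> is already the
  global one: a closed walk of length \<open>n\<close> at \<open>v\<close> can be inserted into a
  round trip from \<open>u\<close> through \<open>v\<close>, and the lengths with and without it
  differ by \<open>n\<close>. Closed walks at \<open>u\<close> concatenate, so their lengths form an
  additive set.\<close>

lemma eventually_closed_walk:
  assumes sc: "strongly_connected G" and pos: "imprimitivity_index G > 0" and u: "u \<in> verts G"
  shows "\<forall>\<^sub>F n in sequentially. imprimitivity_index G dvd n \<longrightarrow> has_walk n u u"
proof -
  let ?S = "{n. has_walk n u u}"
  let ?T = "{length p | u p. awalk u p u \<and> p \<noteq> []}"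
  have "Gcd ?T dvd n" if "n \<in> ?S" for n
  \<comment> \<open>Length zero is split off because the empty walk counts in \<open>?S\<close> but
    is excluded from \<open>?T\<close>.\<close>
  proof (cases "n = 0")
    case False
    then have "n \<in> ?T" using that by (auto simp: has_walk_def)
    then show ?thesis by (rule Gcd_dvd)
  qed simp
  then have "Gcd ?T dvd Gcd ?S" by (rule Gcd_greatest)
  moreover have "Gcd ?S dvd n" if n: "n \<in> ?T" for n
  proof -
    obtain v where v: "v \<in> verts G" "has_walk n v v"
      using n awalk_hd_in_verts unfolding has_walk_def by blast
    obtain a b where ab: "has_walk a u v" "has_walk b v u"
      using sc u v(1) reachable_has_walk unfolding strongly_connected_def by metis
    have "a + b \<in> ?S" "a + b + n \<in> ?S"
      using has_walk_trans[OF ab] has_walk_trans[OF has_walk_trans[OF ab(1) v(2)] ab(2)]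
      by (auto simp: add_ac)
    note this[THEN Gcd_dvd]
    then show ?thesis by (simp only: dvd_add_right_iff)
  qed
  then have "Gcd ?S dvd Gcd ?T" by (rule Gcd_greatest)
  ultimately have "Gcd ?S = Gcd ?T" by (intro dvd_antisym)
  then have eq: "Gcd ?S = imprimitivity_index G"
    unfolding imprimitivity_index_def .
  have "a + b \<in> ?S" if "a \<in> ?S" "b \<in> ?S" for a b
    using that has_walk_trans by blast
  from eventually_multiple_in_additive_set[of ?S, OF this] pos show ?thesis
    unfolding eq by simp
qed

text \<open>One walk of some length \<open>l\<close> from \<open>x\<close> to \<open>y\<close>
  exists, and its parity is forced because arcs alternate between \<open>U 1\<close> and
  \<open>U 2\<close>. Closed walks at \<open>x\<close> of every large even length, put in front of
  it, give all large lengths of that parity.\<close>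

lemma eventually_walk_of_parity:
  assumes sc: "strongly_connected G" and two: "imprimitivity_index G = 2"
    and U: "imprimitivity_sets G U" and x: "x \<in> verts G" and y: "y \<in> verts G"
  shows "\<forall>\<^sub>F n in sequentially. (even n \<longleftrightarrow> (x \<in> U 1 \<longleftrightarrow> y \<in> U 1)) \<longrightarrow> has_walk n x y"
proof -
  have idx: "{1..2::nat} = {1, 2}" by auto
  have "(1::nat) \<noteq> 2" by simp
  then have disj: "U 1 \<inter> U 2 = {}"
    using U unfolding imprimitivity_sets_def Let_def two idx disjoint_family_on_def by blast
  have "\<forall>a\<in>arcs G. \<exists>i\<in>{1, 2}. tail G a \<in> U i \<and> head G a \<in> U (if i = 2 then 1 else i + 1)"
    using U unfolding imprimitivity_sets_def Let_def two idx by (elim conjE)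
  then have cross: "tail G a \<in> U 1 \<and> head G a \<in> U 2 \<or> tail G a \<in> U 2 \<and> head G a \<in> U 1"
    if "a \<in> arcs G" for a
    using that by (fastforce simp: numeral_2_eq_2)
  have step: "v \<in> UNIV \<and> (v \<in> U 1 \<longleftrightarrow> u \<notin> U 1)" if "u \<in> UNIV" "u \<rightarrow> v" for u v
    using that(2) cross disj by (elim reachableE) blast
  obtain l where l: "has_walk l x y"
    using sc x y reachable_has_walk unfolding strongly_connected_def by metis
  then have l_par: "even l \<longleftrightarrow> (x \<in> U 1 \<longleftrightarrow> y \<in> U 1)"
    using has_walk_parity[OF step] by blast
  obtain N where N: "\<And>n. n \<ge> N \<Longrightarrow> even n \<Longrightarrow> has_walk n x x"
    using eventually_closed_walk[OF sc _ x] two by (auto simp: eventually_sequentially)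
  have "has_walk n x y" if "n \<ge> N + l" "even n \<longleftrightarrow> (x \<in> U 1 \<longleftrightarrow> y \<in> U 1)" for n
  proof -
    have "even (n - l)" "n - l \<ge> N" using that l_par by auto
    then show ?thesis using has_walk_trans[OF N l] that(1) by fastforce
  qed
  then show ?thesis unfolding eventually_sequentially by blast
qed

end

section \<open>Limits of competition graphs\<close>

lemma (in wf_digraph) parcs_competition_graph_iff:
  "(u, v) \<in> parcs (competition_graph m G) \<longleftrightarrow> u \<noteq> v \<and> (\<exists>w. has_walk m u w \<and> has_walk m v w)"
  unfolding competition_graph_def has_walk_def using awalk_hd_in_verts by auto

text \<open>There are finitely many pairs of vertices, so thresholds found pair by pair combine into
  one. Adjacency can therefore be studied for a fixed pair.\<close>

lemma (in fin_digraph) competition_graph_converges: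
  assumes "pverts H = verts G" "parcs H \<subseteq> verts G \<times> verts G" "\<And>u. (u, u) \<notin> parcs H"
    and lim: "\<And>u v. u \<in> verts G \<Longrightarrow> v \<in> verts G \<Longrightarrow> u \<noteq> v \<Longrightarrow>
      \<forall>\<^sub>F m in sequentially. (\<exists>w. has_walk m u w \<and> has_walk m v w) \<longleftrightarrow> (u, v) \<in> parcs H"
  shows "graph_seq_converges (\<lambda>m. competition_graph m G) H"
proof -
  have "\<forall>\<^sub>F m in sequentially.
    (fst a, snd a) \<in> parcs (competition_graph m G) \<longleftrightarrow> (fst a, snd a) \<in> parcs H"
    if "a \<in> verts G \<times> verts G" for a
  proof (cases "fst a = snd a")
    case True
    then show ?thesis using assms(3) by (simp add: parcs_competition_graph_iff)
  next
    case False
    then show ?thesis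
      using lim[of "fst a" "snd a"] that by (auto simp: parcs_competition_graph_iff)
  qed
  then have "\<forall>\<^sub>F m in sequentially. \<forall>a\<in>verts G \<times> verts G.
    (fst a, snd a) \<in> parcs (competition_graph m G) \<longleftrightarrow> (fst a, snd a) \<in> parcs H"
    by (intro eventually_ball_finite) auto
  then show ?thesis
    unfolding graph_seq_converges_def
  proof eventually_elim
    case (elim m)
    have "parcs (competition_graph m G) \<subseteq> verts G \<times> verts G" "pverts (competition_graph m G) = verts G"
      unfolding competition_graph_def by auto
    then have "parcs (competition_graph m G) = parcs H"
      using elim assms(2) by (intro set_eqI) (metis prod.collapse subsetD)
    then show ?case
      using assms(1) \<open>pverts (competition_graph m G) = verts G\<close>
      by (intro pair_pre_digraph.equality) auto
  qed
qed

text \<open>The limit will be equal to the claimed graph, so the identity is the required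
  isomorphism. Its head and tail components are those of \<open>G\<close>, so that
  \<open>app_iso\<close> returns \<open>G\<close> itself.\<close>

lemma (in wf_digraph) digraph_iso_refl: "digraph_iso G G"
proof -
  let ?f = "\<lparr>iso_verts = id, iso_arcs = id, iso_head = head G, iso_tail = tail G\<rparr>"
  have "digraph_isomorphism ?f"
    unfolding digraph_isomorphism_def using wf_digraph by simp
  moreover have "G = app_iso ?f G" by (simp add: app_iso_def)
  ultimately show ?thesis unfolding digraph_iso_def by blast
qed

section \<open>Strong components of a multipartite tournament\<close>

locale ordered_multipartite_tournament = digraph D for D :: "('a, 'b) pre_digraph" +
  fixes k s :: nat and V :: "nat \<Rightarrow> 'a set" and Q :: "nat \<Rightarrow> ('a, 'b) pre_digraph"
  assumes tournament: "multipartite_tournament k V D"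
    and components: "ordered_strong_components D s Q"
begin

lemma parts_disjoint: "i \<in> {1..k} \<Longrightarrow> j \<in> {1..k} \<Longrightarrow> u \<in> V i \<Longrightarrow> u \<in> V j \<Longrightarrow> i = j"
  using tournament unfolding multipartite_tournament_def disjoint_family_on_def by blast

lemma part_of: "u \<in> verts D \<Longrightarrow> \<exists>i\<in>{1..k}. u \<in> V i"
  using tournament
  unfolding multipartite_tournament_def orientation_of_def complete_multipartite_graph_def by auto

lemma arcs_ends_iff:
  "u \<rightarrow>\<^bsub>D\<^esub> v \<or> v \<rightarrow>\<^bsub>D\<^esub> u \<longleftrightarrow> (\<exists>i\<in>{1..k}. \<exists>j\<in>{1..k}. i \<noteq> j \<and> u \<in> V i \<and> v \<in> V j)"
proof -
  have "(u, v) \<in> arcs_ends D \<union> (arcs_ends D)\<inverse> \<longleftrightarrow>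
    (u, v) \<in> parcs (complete_multipartite_graph k V)"
    using tournament unfolding multipartite_tournament_def orientation_of_def by simp
  then show ?thesis by (simp add: complete_multipartite_graph_def)
qed

lemma arc_changes_part: "u \<rightarrow>\<^bsub>D\<^esub> v \<Longrightarrow> i \<in> {1..k} \<Longrightarrow> u \<in> V i \<Longrightarrow> v \<notin> V i"
  using arcs_ends_iff[of u v] parts_disjoint by metis

lemma component_scc: "i \<in> {1..s} \<Longrightarrow> Q i \<in> sccs"
  using components unfolding ordered_strong_components_def bij_betw_def by blast

lemma component_induced: "i \<in> {1..s} \<Longrightarrow> induced_subgraph (Q i) D"
  using component_scc in_sccs_imp_induced by blast

lemma component_strongly_connected: "i \<in> {1..s} \<Longrightarrow> strongly_connected (Q i)"
  using component_scc by blast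

lemma component_verts: "i \<in> {1..s} \<Longrightarrow> u \<in> verts (Q i) \<Longrightarrow> u \<in> verts D"
  using component_induced by blast

lemma component_of: "u \<in> verts D \<Longrightarrow> \<exists>i\<in>{1..s}. u \<in> verts (Q i)"
proof -
  assume "u \<in> verts D"
  then have "scc_of u \<in> verts ` Q ` {1..s}" "u \<in> scc_of u"
    using scc_of_in_sccs_verts in_scc_of_self components
    unfolding ordered_strong_components_def bij_betw_def sccs_verts_conv by auto
  then show ?thesis by blast
qed

lemma components_disjoint:
  assumes "i \<in> {1..s}" "j \<in> {1..s}" "u \<in> verts (Q i)" "u \<in> verts (Q j)"
  shows "i = j"
proof -
  have "Q i = Q j"
    using scc_disj[OF component_scc component_scc] assms by blast
  then show ?thesis
    using components assms unfolding ordered_strong_components_def bij_betw_def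
    by (metis inj_onD)
qed

lemma arc_component_le:
  "i \<in> {1..s} \<Longrightarrow> j \<in> {1..s} \<Longrightarrow> u \<in> verts (Q i) \<Longrightarrow> v \<in> verts (Q j) \<Longrightarrow> u \<rightarrow>\<^bsub>D\<^esub> v \<Longrightarrow> i \<le> j"
  using components unfolding ordered_strong_components_def by (meson not_le)

text \<open>A partite set containing exactly one of \<open>u\<close> and \<open>v\<close> separates
  them, hence they are joined by an arc; the order of the components rules out the backward
  direction.\<close>

lemma arc_forward:
  assumes "i \<in> {1..s}" "j \<in> {1..s}" "i < j" "u \<in> verts (Q i)" "v \<in> verts (Q j)"
    and "p \<in> {1..k}" "u \<in> V p \<longleftrightarrow> v \<notin> V p"
  shows "u \<rightarrow>\<^bsub>D\<^esub> v"
proof -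
  obtain a b where "a \<in> {1..k}" "u \<in> V a" "b \<in> {1..k}" "v \<in> V b"
    using part_of component_verts assms(1,2,4,5) by metis
  moreover from this have "a \<noteq> b" using assms(6,7) parts_disjoint by metis
  ultimately have "u \<rightarrow>\<^bsub>D\<^esub> v \<or> v \<rightarrow>\<^bsub>D\<^esub> u" using arcs_ends_iff by blast
  then show ?thesis using arc_component_le assms(1-5) by (meson not_le)
qed

text \<open>Without loops, no arc stays inside a one-vertex component, so each step raises the
  component index by at least one, and the index never exceeds \<open>s\<close>.\<close>

lemma walk_from_trivial_components_bounded:
  assumes trivial: "\<And>i. t < i \<Longrightarrow> i \<le> s \<Longrightarrow> trivial_component (Q i)"
    and "has_walk n u w" "u \<in> verts (Q i)" "t < i" "i \<in> {1..s}"
  shows "i + n \<le> s"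
  using assms(2-5)
proof (induction n arbitrary: u i)
  case (Suc n)
  then obtain v where v: "u \<rightarrow>\<^bsub>D\<^esub> v" "has_walk n v w" unfolding has_walk_Suc by blast
  then obtain j where j: "j \<in> {1..s}" "v \<in> verts (Q j)"
    using component_of adj_in_verts by blast
  have "i \<le> j" using arc_component_le Suc.prems j v by blast
  moreover have "i \<noteq> j"
  proof
    assume "i = j"
    moreover have "card (verts (Q i)) = 1"
      using trivial[OF Suc.prems(3)] Suc.prems(4) unfolding trivial_component_def by simp
    then obtain a where "verts (Q i) = {a}" by (rule card_1_singletonE)
    ultimately show False using j v Suc.prems adj_not_same by auto
  qed
  ultimately show ?case using Suc.IH[OF v(2) j(2) _ j(1)] Suc.prems by auto
qed simp

end

section \<open>A last nontrivial component of period two\<close>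

locale bipartite_last_component = ordered_multipartite_tournament D k s V Q
  for D :: "('a, 'b) pre_digraph" and k s :: nat and V :: "nat \<Rightarrow> 'a set"
    and Q :: "nat \<Rightarrow> ('a, 'b) pre_digraph" +
  fixes t r :: nat and U :: "nat \<Rightarrow> 'a set"
  assumes k: "k \<ge> 2" and last: "last_nontrivial_component s Q t"
    and index: "imprimitivity_index (Q t) = 2" and sets: "imprimitivity_sets (Q t) U"
    and U1: "V 1 \<inter> verts (Q t) = U 1" and U2: "V 2 \<inter> verts (Q t) = U 2"
    and r: "r = head_completing_index k V Q t"
begin

section \<open>Partite sets of the last nontrivial component and the head completing index\<close>

lemma t: "t \<in> {1..s}"
  using last by (simp add: last_nontrivial_component_def)

lemma one_two: "1 \<in> {1..k}" "2 \<in> {1..k}" "(1::nat) \<noteq> 2"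
  using k by auto

lemma sets_nonempty: "U 1 \<noteq> {}" "U 2 \<noteq> {}" and sets_cover: "U 1 \<union> U 2 = verts (Q t)"
proof -
  have "{1..2::nat} = {1, 2}" by auto
  then show "U 1 \<noteq> {}" "U 2 \<noteq> {}" "U 1 \<union> U 2 = verts (Q t)"
    using sets unfolding imprimitivity_sets_def Let_def index by auto
qed

lemma parts_of_last: "partite_sets_of_component k V (Q t) = {U 1, U 2}"
proof -
  have "verts (Q t) \<inter> V j \<noteq> {} \<Longrightarrow> j = 1 \<or> j = 2" if "j \<in> {1..k}" for j
    using that sets_cover U1 U2 parts_disjoint one_two by blast
  moreover have "U 1 = verts (Q t) \<inter> V 1" "U 2 = verts (Q t) \<inter> V 2"
    using U1 U2 by auto
  ultimately show ?thesis
    unfolding partite_sets_of_component_def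
    using one_two sets_nonempty by (auto 4 4)
qed

text \<open>The partite sets of \<open>Q t\<close> are the nonempty sets \<open>U 1\<close> and
  \<open>U 2\<close>, so a nonempty part of \<open>Q i\<close> inside \<open>V j\<close> is related
  to one of them exactly when \<open>j\<close> is 1 or 2. This replaces the condition in the head
  completing index by a plain inclusion.\<close>

lemma unrelated_part_iff:
  assumes "i \<in> {1..s}"
  shows "(\<exists>X \<in> partite_sets_of_component k V (Q i).
      \<forall>Y \<in> partite_sets_of_component k V (Q t). \<not> partite_related k V X Y) \<longleftrightarrow>
    \<not> verts (Q i) \<subseteq> V 1 \<union> V 2"
proof
  assume "\<exists>X \<in> partite_sets_of_component k V (Q i).
      \<forall>Y \<in> partite_sets_of_component k V (Q t). \<not> partite_related k V X Y"
  then obtain j x where j: "j \<in> {1..k}" "x \<in> verts (Q i)" "x \<in> V j"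
    and "\<not> partite_related k V (verts (Q i) \<inter> V j) (U 1)"
    and "\<not> partite_related k V (verts (Q i) \<inter> V j) (U 2)"
    unfolding parts_of_last unfolding partite_sets_of_component_def by blast
  then have "j \<noteq> 1" "j \<noteq> 2"
    unfolding partite_related_def using U1 U2 by blast+
  then have "x \<notin> V 1" "x \<notin> V 2"
    using j parts_disjoint one_two by blast+
  then show "\<not> verts (Q i) \<subseteq> V 1 \<union> V 2" using j by blast
next
  assume "\<not> verts (Q i) \<subseteq> V 1 \<union> V 2"
  then obtain x where x: "x \<in> verts (Q i)" "x \<notin> V 1" "x \<notin> V 2" by blast
  then obtain j where j: "j \<in> {1..k}" "x \<in> V j"
    using part_of component_verts[OF assms] by blast
  have "\<not> partite_related k V (verts (Q i) \<inter> V j) Y" if "Y \<in> {U 1, U 2}" for Y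
  proof
    assume "partite_related k V (verts (Q i) \<inter> V j) Y"
    then obtain p where p: "p \<in> {1..k}" "x \<in> V p" "Y \<subseteq> V p"
      unfolding partite_related_def using x j by blast
    from that p(3) have "\<exists>q\<in>{1, 2}. \<exists>y. y \<in> V q \<and> y \<in> V p"
      using U1 U2 sets_nonempty by blast
    then have "p \<in> {1, 2}" using parts_disjoint p(1) one_two by blast
    then show False using x p by blast
  qed
  moreover have "verts (Q i) \<inter> V j \<in> partite_sets_of_component k V (Q i)"
    unfolding partite_sets_of_component_def using x j by blast
  ultimately show "\<exists>X \<in> partite_sets_of_component k V (Q i).
      \<forall>Y \<in> partite_sets_of_component k V (Q t). \<not> partite_related k V X Y"
    unfolding parts_of_last by blast
qed

lemma head_completing_index_cases:
  obtains R where "R = {i. 1 \<le> i \<and> i < t \<and> \<not> verts (Q i) \<subseteq> V 1 \<union> V 2}" "finite R"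
    "r = (if R = {} then 0 else Max R)"
proof -
  have eq: "{i. 1 \<le> i \<and> i < t \<and> (\<exists>X \<in> partite_sets_of_component k V (Q i).
      \<forall>Y \<in> partite_sets_of_component k V (Q t). \<not> partite_related k V X Y)} =
    {i. 1 \<le> i \<and> i < t \<and> \<not> verts (Q i) \<subseteq> V 1 \<union> V 2}"
  proof (intro Collect_cong conj_cong refl)
    fix i assume "1 \<le> i" "i < t"
    then show "(\<exists>X \<in> partite_sets_of_component k V (Q i).
        \<forall>Y \<in> partite_sets_of_component k V (Q t). \<not> partite_related k V X Y) \<longleftrightarrow>
      \<not> verts (Q i) \<subseteq> V 1 \<union> V 2"
      using t by (intro unrelated_part_iff) simp
  qed
  show ?thesis
    by (rule that[OF refl]) (simp, simp only: r head_completing_index_def Let_def eq)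
qed

lemma r_less: "r < t"
proof -
  obtain R where R: "R = {i. 1 \<le> i \<and> i < t \<and> \<not> verts (Q i) \<subseteq> V 1 \<union> V 2}" "finite R"
    and r: "r = (if R = {} then 0 else Max R)"
    by (rule head_completing_index_cases)
  show ?thesis using r R Max_in[of R] t by (cases "R = {}") auto
qed

lemma not_bipartite_at_r:
  assumes "r > 0" shows "\<not> verts (Q r) \<subseteq> V 1 \<union> V 2"
proof -
  obtain R where R: "R = {i. 1 \<le> i \<and> i < t \<and> \<not> verts (Q i) \<subseteq> V 1 \<union> V 2}" "finite R"
    and r: "r = (if R = {} then 0 else Max R)"
    by (rule head_completing_index_cases)
  have "r \<in> R" using r R(2) Max_in assms by (auto split: if_splits)
  then show ?thesis using R(1) by blast
qed

text \<open>Below \<open>t\<close>, a component not inside \<open>V 1 \<union> V 2\<close> would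
  contradict the maximality of \<open>r\<close>. The component \<open>Q t\<close> itself is covered
  by \<open>U 1\<close> and \<open>U 2\<close>.\<close>

lemma bipartite_above_r:
  assumes "r < i" "i \<le> t" shows "verts (Q i) \<subseteq> V 1 \<union> V 2"
proof (cases "i = t")
  case True
  then show ?thesis using sets_cover U1 U2 by blast
next
  case False
  obtain R where R: "R = {i. 1 \<le> i \<and> i < t \<and> \<not> verts (Q i) \<subseteq> V 1 \<union> V 2}" "finite R"
    and r: "r = (if R = {} then 0 else Max R)"
    by (rule head_completing_index_cases)
  have "i \<notin> R" using Max_ge[OF R(2)] assms r by (force split: if_splits)
  then show ?thesis using R(1) assms False by auto
qed

section \<open>Phases of long walks into the last nontrivial component\<close>

definition anchor :: "bool \<Rightarrow> 'a" where
  "anchor b = (SOME y. y \<in> (if b then U 1 else U 2))"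

lemma anchor: "anchor True \<in> U 1" "anchor False \<in> U 2"
  unfolding anchor_def using sets_nonempty by (auto intro: someI_ex)

lemma anchor_part: "anchor True \<in> V 1" "anchor False \<in> V 2"
  using anchor U1 U2 by blast+

lemma anchor_not_part: "anchor True \<notin> V 2" "anchor False \<notin> V 1"
  using anchor_part parts_disjoint one_two by blast+

lemma anchor_verts: "anchor b \<in> verts (Q t)"
  using anchor sets_cover by (cases b) auto

text \<open>The Boolean is the phase: for true, long even walks lead into $U_1$ and long odd ones into $U_2$.\<close>

definition funnels :: "bool \<Rightarrow> 'a \<Rightarrow> bool" where
  "funnels b x \<longleftrightarrow> (\<forall>\<^sub>F n in sequentially. has_walk n x (anchor (b = even n)))"

text \<open>The anchor prescribed for length \<open>n\<close> lies on the side of \<open>x\<close>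
  exactly when \<open>n\<close> is even, which is the parity for which long walks exist inside
  \<open>Q t\<close>; these are also walks of \<open>D\<close>.\<close>

lemma funnels_last:
  assumes "x \<in> verts (Q t)" shows "funnels (x \<in> V 1) x"
proof -
  have sub: "subgraph (Q t) D" using component_induced[OF t] by blast
  then interpret H: wf_digraph "Q t" by (rule subgraphE)
  note walk = H.eventually_walk_of_parity[OF component_strongly_connected[OF t] index sets assms]
  have x: "x \<in> V 1 \<longleftrightarrow> x \<in> U 1" using U1 assms by blast
  have "anchor False \<notin> U 1" using anchor_not_part U1 by blast
  note color = x this anchor(1)
  show ?thesis
    unfolding funnels_def
    using walk[OF anchor_verts[of True]] walk[OF anchor_verts[of False]]
  proof eventually_elim
    case (elim n)
    then show ?case
      using color by (cases "(x \<in> V 1) = even n") (auto intro: has_walk_subgraph[OF sub])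
  qed
qed

text \<open>Putting a walk of length \<open>l\<close> in front keeps the phase for even
  \<open>l\<close> and flips it for odd \<open>l\<close>. The set \<open>B\<close> collects the
  phases known for \<open>y\<close>: a singleton when one phase is known, \<open>UNIV\<close> when
  both are.\<close>

lemma funnels_walk:
  assumes walk: "has_walk l x y" and y: "\<And>b. b \<in> B \<Longrightarrow> funnels b y" and b: "(b = even l) \<in> B"
  shows "funnels b x"
proof -
  obtain N where N: "\<And>n. n \<ge> N \<Longrightarrow> has_walk n y (anchor ((b = even l) = even n))"
    using y[OF b] unfolding funnels_def eventually_sequentially by blast
  have "has_walk n x (anchor (b = even n))" if "n \<ge> N + l" for n
  proof -
    \<comment> \<open>The bound \<open>n \<ge> N + l\<close> makes the natural subtraction exact, so
      parities subtract as well.\<close>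
    have "((b = even l) = even (n - l)) = (b = even n)"
      using that by auto
    then show ?thesis
      using has_walk_trans[OF walk N[of "n - l"]] that by simp
  qed
  then show ?thesis unfolding funnels_def eventually_sequentially by blast
qed

text \<open>Before \<open>Q t\<close>, a vertex missing \<open>V 1\<close> has an arc to the anchor
  in \<open>U 1\<close>, whose phase is true; the single step flips it to false. The case of
  \<open>V 2\<close> is symmetric. Inside \<open>Q t\<close>, missing one part means lying in the
  other.\<close>

lemma funnels_outside_part:
  assumes i: "i \<in> {1..t}" and x: "x \<in> verts (Q i)"
  shows "x \<notin> V 1 \<Longrightarrow> funnels False x" "x \<notin> V 2 \<Longrightarrow> funnels True x"
proof -
  have s: "i \<in> {1..s}" using i t by simp
  \<comment> \<open>Both claims at once: \<open>V p\<close> is the part that \<open>x\<close>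
    misses, \<open>c\<close> the phase of the anchor lying in it, and \<open>b\<close> the opposite
    phase. The last premise handles \<open>i = t\<close>.\<close>
  have funnel: "funnels b x" if p: "p \<in> {1, 2}" "x \<notin> V p" and a: "anchor c \<in> V p" "b \<longleftrightarrow> \<not> c"
    and last: "i = t \<Longrightarrow> x \<in> V 1 \<longleftrightarrow> b" for b c p
  proof (cases "i = t")
    case True
    then show ?thesis using funnels_last[of x] last x by simp
  next
    case False
    then have "x \<rightarrow>\<^bsub>D\<^esub> anchor c"
      using arc_forward[OF s t _ x anchor_verts, of p c] i p a one_two by auto
    then have walk: "has_walk 1 x (anchor c)" by (rule has_walk_adj)
    have "anchor c \<in> V 1 \<longleftrightarrow> c" using anchor_part anchor_not_part by (cases c) auto
    then have "funnels c (anchor c)" using funnels_last[OF anchor_verts[of c]] by simp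
    then show ?thesis using funnels_walk[OF walk, of "{c}" b] a by auto
  qed
  show "x \<notin> V 1 \<Longrightarrow> funnels False x"
    using funnel[of 1 True False] anchor_part by simp
  have "x \<notin> V 2 \<Longrightarrow> i = t \<Longrightarrow> x \<in> V 1" using x sets_cover U1 U2 by blast
  then show "x \<notin> V 2 \<Longrightarrow> funnels True x"
    using funnel[of 2 False True] anchor_part by simp
qed

text \<open>A vertex \<open>z\<close> of \<open>Q r\<close> outside \<open>V 1 \<union> V 2\<close>
  has both phases. Either \<open>x\<close> also misses both parts, or it reaches \<open>z\<close>:
  by strong connectivity within \<open>Q r\<close>, or by an arc from an earlier component because
  \<open>z\<close> misses the part of \<open>x\<close>. Both phases then pass back along this walk,
  whatever its length.\<close>

lemma funnels_head:
  assumes i: "i \<in> {1..r}" and x: "x \<in> verts (Q i)"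
  shows "funnels b x"
proof -
  have r: "r > 0" "r \<in> {1..t}" "r \<in> {1..s}" and i': "i \<in> {1..t}" "i \<in> {1..s}"
    using i r_less t by auto
  obtain z where z: "z \<in> verts (Q r)" "z \<notin> V 1" "z \<notin> V 2"
    using not_bipartite_at_r[OF r(1)] by blast
  have fz: "funnels b z" for b
    using funnels_outside_part[OF r(2) z(1)] z by (cases b) auto
  consider "x \<notin> V 1" "x \<notin> V 2" | "i = r" | p where "i < r" "p \<in> {1, 2}" "x \<in> V p"
    using i by fastforce
  then have "(\<forall>b. funnels b x) \<or> (\<exists>l. has_walk l x z)"
  proof cases
    case 1
    then show ?thesis using funnels_outside_part[OF i'(1) x] by (metis (full_types))
  next
    case 2
    then have "x \<rightarrow>\<^sup>*\<^bsub>Q r\<^esub> z"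
      using component_strongly_connected[OF r(3)] x z unfolding strongly_connected_def by blast
    moreover have "subgraph (Q r) D" using component_induced[OF r(3)] by blast
    ultimately have "x \<rightarrow>\<^sup>*\<^bsub>D\<^esub> z" by (rule reachable_mono)
    then show ?thesis using reachable_has_walk by blast
  next
    case 3
    then have "x \<rightarrow>\<^bsub>D\<^esub> z"
      using arc_forward[OF i'(2) r(3) _ x z(1), of p] z one_two by auto
    then show ?thesis using has_walk_adj by blast
  qed
  then show ?thesis using funnels_walk[of _ x z UNIV b] fz by blast
qed

text \<open>The anchor reached depends only on the phase and on the parity of the length, so equal
  phases give the same target.\<close>

lemma funnels_common:
  assumes "funnels b u" "funnels b v"
  shows "\<forall>\<^sub>F n in sequentially. \<exists>w. has_walk n u w \<and> has_walk n v w"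
  using assms unfolding funnels_def by eventually_elim blast

section \<open>Common targets, the tail and the two limit graphs\<close>

abbreviation comp_verts :: "nat \<Rightarrow> nat \<Rightarrow> 'a set" where
  "comp_verts a b \<equiv> \<Union>i\<in>{a..b}. verts (Q i)"

lemma comp_verts_disjoint:
  assumes "1 \<le> a" "b < c" "d \<le> s"
  shows "comp_verts a b \<inter> comp_verts c d = {}"
proof -
  have "verts (Q i) \<inter> verts (Q j) = {}" if "i \<in> {a..b}" "j \<in> {c..d}" for i j
  proof -
    have "i \<in> {1..s}" "j \<in> {1..s}" "i \<noteq> j" using that assms by auto
    then show ?thesis using components_disjoint[of i j] by blast
  qed
  then show ?thesis by blast
qed

lemma comp_verts_cover: "verts D = comp_verts 1 t \<union> comp_verts (t + 1) s"
proof -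
  have "{1..s} = {1..t} \<union> {t + 1..s}" using t by auto
  then have "comp_verts 1 t \<union> comp_verts (t + 1) s = comp_verts 1 s" by (simp only: UN_Un)
  moreover have "verts D = comp_verts 1 s"
  proof (intro equalityI subsetI)
    fix u assume "u \<in> verts D"
    then show "u \<in> comp_verts 1 s" using component_of by blast
  next
    fix u assume "u \<in> comp_verts 1 s"
    then show "u \<in> verts D" using component_verts by blast
  qed
  ultimately show ?thesis by (simp only:)
qed

lemma no_long_walk_in_tail:
  assumes "u \<in> comp_verts (t + 1) s" "n > s"
  shows "\<not> has_walk n u w"
proof
  assume walk: "has_walk n u w"
  obtain i where "i \<in> {t + 1..s}" "u \<in> verts (Q i)"
    using assms(1) by blast
  then have i: "t < i" "i \<in> {1..s}" "u \<in> verts (Q i)" by auto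
  have "trivial_component (Q i)" if "t < i" "i \<le> s" for i
    using that last unfolding last_nontrivial_component_def by blast
  from walk_from_trivial_components_bounded[OF this walk i(3,1,2)] show False
    using assms(2) by simp
qed

lemma no_common_target_in_tail:
  assumes "u \<in> comp_verts (t + 1) s \<or> v \<in> comp_verts (t + 1) s"
  shows "\<forall>\<^sub>F n in sequentially. \<not> (\<exists>w. has_walk n u w \<and> has_walk n v w)"
  using eventually_gt_at_top[of s]
proof eventually_elim
  case (elim n)
  then show ?case using assms no_long_walk_in_tail by blast
qed

text \<open>The components after \<open>Q r\<close> all lie in \<open>V 1 \<union> V 2\<close>, and
  no arc leaves their union. Every arc there switches parts, so walks of equal length from different
  parts end in different parts.\<close>

lemma no_common_target_across_parts:
  assumes tail: "comp_verts (t + 1) s \<subseteq> V 1 \<union> V 2"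
    and u: "u \<in> V 1 \<inter> comp_verts (r + 1) t" and v: "v \<in> V 2 \<inter> comp_verts (r + 1) t"
  shows "\<not> (has_walk n u w \<and> has_walk n v w)"
proof
  assume walks: "has_walk n u w \<and> has_walk n v w"
  let ?R = "comp_verts (r + 1) s"
  have "x \<in> V 1 \<union> V 2" if x: "x \<in> ?R" for x
  proof -
    obtain i where i: "i \<in> {r + 1..s}" "x \<in> verts (Q i)" using x by blast
    show ?thesis
    proof (cases "i \<le> t")
      case True
      then show ?thesis using bipartite_above_r[of i] i by auto
    next
      case False
      then have "x \<in> comp_verts (t + 1) s" using i by force
      then show ?thesis using tail by blast
    qed
  qed
  then have in_parts: "?R \<subseteq> V 1 \<union> V 2" by blast
  have step: "y \<in> ?R \<and> (y \<in> V 1 \<longleftrightarrow> x \<notin> V 1)" if x: "x \<in> ?R" and arc: "x \<rightarrow>\<^bsub>D\<^esub> y" for x y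
  proof -
    obtain i where i: "i \<in> {r + 1..s}" "x \<in> verts (Q i)" using x by blast
    obtain j where j: "j \<in> {1..s}" "y \<in> verts (Q j)"
      using component_of adj_in_verts(2)[OF arc] by blast
    have "i \<le> j" using arc_component_le[OF _ j(1) i(2) j(2) arc] i(1) by simp
    then have "y \<in> ?R" using i j by force
    then show ?thesis
      using in_parts x arc_changes_part[OF arc one_two(1)] arc_changes_part[OF arc one_two(2)]
      by blast
  qed
  have "comp_verts (r + 1) t \<subseteq> ?R" using t by force
  then have "u \<in> ?R" "v \<in> ?R" using u v by blast+
  then have "even n \<longleftrightarrow> (u \<in> V 1 \<longleftrightarrow> w \<in> V 1)" "even n \<longleftrightarrow> (v \<in> V 1 \<longleftrightarrow> w \<in> V 1)"
    using has_walk_parity[OF step] walks by blast+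
  moreover have "v \<notin> V 1" using v parts_disjoint one_two by blast
  ultimately show False using u by blast
qed

text \<open>No vertex lies in both \<open>V 1\<close> and \<open>V 2\<close>, so \<open>x\<close>
  has at least one phase. Both anchors have an arc to \<open>w\<close>; one further step thus
  reaches \<open>w\<close> regardless of parity.\<close>

lemma eventually_walk_to_tail_outside_parts:
  assumes w: "w \<in> comp_verts (t + 1) s" "w \<notin> V 1" "w \<notin> V 2" and x: "x \<in> comp_verts 1 t"
  shows "\<forall>\<^sub>F n in sequentially. has_walk n x w"
proof -
  obtain i where i: "i \<in> {1..t}" "x \<in> verts (Q i)" using x by blast
  obtain j where "j \<in> {t + 1..s}" "w \<in> verts (Q j)" using w(1) by blast
  then have j: "j \<in> {1..s}" "t < j" "w \<in> verts (Q j)" by auto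
  have "x \<notin> V 1 \<or> x \<notin> V 2" using parts_disjoint one_two by blast
  then obtain b where "funnels b x" using funnels_outside_part[OF i] by blast
  have "anchor c \<rightarrow>\<^bsub>D\<^esub> w" for c
    using arc_forward[OF t j(1,2) anchor_verts j(3) one_two(1), of c]
      arc_forward[OF t j(1,2) anchor_verts j(3) one_two(2), of c] anchor_part w
    by (cases c) auto
  then have arc: "has_walk 1 (anchor c) w" for c by (rule has_walk_adj)
  have "\<forall>\<^sub>F n in sequentially. has_walk (Suc n) x w"
    using \<open>funnels b x\<close> unfolding funnels_def
    by eventually_elim (use has_walk_trans[OF _ arc] in fastforce)
  then show ?thesis by (rule eventually_sequentially_Suc[THEN iffD1])
qed

text \<open>Vertices of \<open>D\<close> up to \<open>Q r\<close> have both phases, those of the two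
  later parts have phase true and false respectively. Sharing a phase is then adjacency in the join,
  parity excludes edges between the two parts, and tail vertices are isolated.\<close>

lemma competition_graphs_converge_split:
  assumes tail: "comp_verts (t + 1) s \<subseteq> V 1 \<union> V 2"
  shows "graph_seq_converges (\<lambda>m. competition_graph m D)
    (graph_union
      (graph_join (complete_graph_on (comp_verts 1 r))
        (graph_union (complete_graph_on (V 1 \<inter> comp_verts (r + 1) t))
          (complete_graph_on (V 2 \<inter> comp_verts (r + 1) t))))
      (edgeless_graph_on (comp_verts (t + 1) s)))" (is "graph_seq_converges _ ?H")
proof -
  define P W Z where defs: "P = comp_verts 1 r" "W = comp_verts (r + 1) t" "Z = comp_verts (t + 1) s"
  define A B where AB_def: "A = V 1 \<inter> W" "B = V 2 \<inter> W"
  \<comment> \<open>The last disjunct records the loops that \<open>graph_join\<close> would create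
    if its arguments overlapped; \<open>PAB\<close> excludes them later.\<close>
  have arcs: "(u, v) \<in> parcs ?H \<longleftrightarrow> u \<noteq> v \<and> (u \<in> P \<and> v \<in> P \<or> u \<in> P \<and> v \<in> A \<union> B \<or>
      u \<in> A \<union> B \<and> v \<in> P \<or> u \<in> A \<and> v \<in> A \<or> u \<in> B \<and> v \<in> B) \<or>
      u = v \<and> u \<in> P \<inter> (A \<union> B)" for u v
    unfolding defs[symmetric] AB_def[symmetric]
    by (auto simp: graph_union_def graph_join_def complete_graph_on_def edgeless_graph_on_def)
  have "{1..t} = {1..r} \<union> {r + 1..t}" using r_less by auto
  then have X: "comp_verts 1 t = P \<union> W" unfolding defs by (simp only: UN_Un)
  have "W \<subseteq> V 1 \<union> V 2" unfolding defs
  proof (rule UN_least)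
    show "verts (Q i) \<subseteq> V 1 \<union> V 2" if "i \<in> {r + 1..t}" for i
      using that by (intro bipartite_above_r) auto
  qed
  then have W: "W = A \<union> B" unfolding AB_def by blast
  have cover: "comp_verts 1 t = P \<union> A \<union> B" unfolding X W by (rule Un_assoc[symmetric])
  have "P \<inter> W = {}"
    unfolding defs by (rule comp_verts_disjoint) (use t in auto)
  then have PAB: "P \<inter> (A \<union> B) = {}" unfolding W .
  have "V 1 \<inter> V 2 = {}" using parts_disjoint one_two by blast
  then have AB: "A \<inter> B = {}" unfolding AB_def by blast
  have "comp_verts 1 t \<inter> Z = {}"
    unfolding defs by (rule comp_verts_disjoint) auto
  then have Z: "(P \<union> A \<union> B) \<inter> Z = {}" unfolding cover .
  have P: "funnels b u" if "u \<in> P" for b u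
    using that funnels_head unfolding defs by blast
  have A: "funnels True u" if u: "u \<in> A" for u
  proof -
    obtain i where "i \<in> {r + 1..t}" "u \<in> verts (Q i)" using u unfolding AB_def defs by blast
    moreover have "u \<notin> V 2" using u parts_disjoint one_two unfolding AB_def by blast
    ultimately show ?thesis using funnels_outside_part(2)[of i u] by simp
  qed
  have B: "funnels False u" if u: "u \<in> B" for u
  proof -
    obtain i where "i \<in> {r + 1..t}" "u \<in> verts (Q i)" using u unfolding AB_def defs by blast
    moreover have "u \<notin> V 1" using u parts_disjoint one_two unfolding AB_def by blast
    ultimately show ?thesis using funnels_outside_part(1)[of i u] by simp
  qed
  show ?thesis
  proof (rule competition_graph_converges)
    show "pverts ?H = verts D"
      unfolding comp_verts_cover cover unfolding defs[symmetric] AB_def[symmetric]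
      by (auto simp: graph_union_def graph_join_def complete_graph_on_def edgeless_graph_on_def)
    show "parcs ?H \<subseteq> verts D \<times> verts D"
    proof (rule subrelI)
      fix u v assume "(u, v) \<in> parcs ?H"
      then have "u \<in> P \<union> A \<union> B" "v \<in> P \<union> A \<union> B" unfolding arcs by blast+
      then show "(u, v) \<in> verts D \<times> verts D" unfolding comp_verts_cover cover by blast
    qed
    show "(u, u) \<notin> parcs ?H" for u
      using PAB arcs by blast
    fix u v assume uv: "u \<in> verts D" "v \<in> verts D" "u \<noteq> v"
    consider (tail) "u \<in> Z \<or> v \<in> Z" | (across) "u \<in> A \<and> v \<in> B \<or> u \<in> B \<and> v \<in> A"
      | (common) b where "(u, v) \<in> parcs ?H" "funnels b u" "funnels b v"
    proof -
      have "u \<in> P \<union> A \<union> B \<union> Z" "v \<in> P \<union> A \<union> B \<union> Z"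
        using uv unfolding comp_verts_cover cover defs(3)[symmetric] by blast+
      then show thesis using uv(3) P A B that unfolding arcs by (elim UnE) blast+
    qed
    then show "\<forall>\<^sub>F m in sequentially.
      (\<exists>w. has_walk m u w \<and> has_walk m v w) \<longleftrightarrow> (u, v) \<in> parcs ?H"
    proof cases
      case tail
      then have "(u, v) \<notin> parcs ?H" using Z uv(3) unfolding arcs by blast
      then show ?thesis
        using no_common_target_in_tail[OF tail[unfolded defs(3)]] by simp
    next
      case across
      then have "(u, v) \<notin> parcs ?H" using AB PAB uv(3) unfolding arcs by blast
      moreover have "\<not> (has_walk m u w \<and> has_walk m v w)" for m w
        using across no_common_target_across_parts[OF assms] unfolding AB_def defs by blast
      ultimately show ?thesis by simp
    next
      case common
      then show ?thesis using funnels_common by simp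
    qed
  qed
qed

text \<open>A tail vertex outside \<open>V 1 \<union> V 2\<close> is a common target of all vertices
  up to \<open>Q t\<close> at every large length, while vertices of the tail itself have no long
  walks.\<close>

lemma competition_graphs_converge_complete:
  assumes tail: "\<not> comp_verts (t + 1) s \<subseteq> V 1 \<union> V 2"
  shows "graph_seq_converges (\<lambda>m. competition_graph m D)
    (graph_union (complete_graph_on (comp_verts 1 t)) (edgeless_graph_on (comp_verts (t + 1) s)))"
    (is "graph_seq_converges _ ?H")
proof -
  define X Z where defs: "X = comp_verts 1 t" "Z = comp_verts (t + 1) s"
  have arcs: "(u, v) \<in> parcs ?H \<longleftrightarrow> u \<noteq> v \<and> u \<in> X \<and> v \<in> X" for u v
    unfolding defs[symmetric]
    by (auto simp: graph_union_def complete_graph_on_def edgeless_graph_on_def)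
  obtain w where w: "w \<in> comp_verts (t + 1) s" "w \<notin> V 1" "w \<notin> V 2" using tail by blast
  have XZ: "X \<inter> Z = {}"
    unfolding defs by (rule comp_verts_disjoint) auto
  show ?thesis
  proof (rule competition_graph_converges)
    show "pverts ?H = verts D"
      unfolding comp_verts_cover
      by (auto simp: graph_union_def complete_graph_on_def edgeless_graph_on_def)
    show "parcs ?H \<subseteq> verts D \<times> verts D"
    proof (rule subrelI)
      fix u v assume "(u, v) \<in> parcs ?H"
      then have "u \<in> X" "v \<in> X" unfolding arcs by blast+
      then show "(u, v) \<in> verts D \<times> verts D" unfolding comp_verts_cover defs by blast
    qed
    show "(u, u) \<notin> parcs ?H" for u
      using arcs by blast
    fix u v assume uv: "u \<in> verts D" "v \<in> verts D" "u \<noteq> v"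
    show "\<forall>\<^sub>F m in sequentially.
      (\<exists>w. has_walk m u w \<and> has_walk m v w) \<longleftrightarrow> (u, v) \<in> parcs ?H"
    proof (cases "u \<in> Z \<or> v \<in> Z")
      case True
      then have "(u, v) \<notin> parcs ?H" using XZ unfolding arcs by blast
      then show ?thesis
        using no_common_target_in_tail[OF True[unfolded defs(2)]] by simp
    next
      case False
      then have X: "u \<in> X" "v \<in> X" using uv comp_verts_cover unfolding defs by blast+
      then have "(u, v) \<in> parcs ?H" using arcs uv(3) by blast
      moreover have "\<forall>\<^sub>F m in sequentially. \<exists>w. has_walk m u w \<and> has_walk m v w"
        using eventually_walk_to_tail_outside_parts[OF w X(1)[unfolded defs]]
          eventually_walk_to_tail_outside_parts[OF w X(2)[unfolded defs]]
        by eventually_elim blast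
      ultimately show ?thesis by simp
    qed
  qed
qed

end

theorem theorem2p7:
  fixes D :: "('a, 'b) pre_digraph"
    and V :: "nat \<Rightarrow> 'a set"
    and Q :: "nat \<Rightarrow> ('a, 'b) pre_digraph"
    and U :: "nat \<Rightarrow> 'a set"
    and k s t r :: nat
    and A\<^sub>1 A\<^sub>2 :: "'a set"
  assumes "k \<ge> 2" and "s \<ge> 2"
    and "multipartite_tournament k V D"
    and "ordered_strong_components D s Q"
    and "last_nontrivial_component s Q t"
    and "imprimitivity_index (Q t) = 2"
    and "t < s"
    and "imprimitivity_sets (Q t) U"
    and "V 1 \<inter> verts (Q t) = U 1" and "V 2 \<inter> verts (Q t) = U 2"
    and "r = head_completing_index k V Q t"
    and "A\<^sub>1 = V 1 \<inter> (\<Union>i\<in>{r+1..t}. verts (Q i))"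
    and "A\<^sub>2 = V 2 \<inter> (\<Union>i\<in>{r+1..t}. verts (Q i))"
  shows "\<exists>G. graph_seq_converges (\<lambda>m. competition_graph m D) G \<and>
    digraph_iso (with_proj G) (with_proj
      (if verts (component_range D Q (t+1) s) \<subseteq> V 1 \<union> V 2
       then graph_union
              (graph_join (complete_graph_on (verts (component_range D Q 1 r)))
                 (graph_union (complete_graph_on A\<^sub>1) (complete_graph_on A\<^sub>2)))
              (edgeless_graph_on (verts (component_range D Q (t+1) s)))
       else graph_union
              (complete_graph_on (verts (component_range D Q 1 t)))
              (edgeless_graph_on (verts (component_range D Q (t+1) s)))))"
proof -
  interpret D: digraph D
    using assms(3) unfolding multipartite_tournament_def orientation_of_def by blast
  interpret bipartite_last_component D k s V Q t r U
    using assms by unfold_locales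
  let ?H = "if comp_verts (t + 1) s \<subseteq> V 1 \<union> V 2
       then graph_union
              (graph_join (complete_graph_on (comp_verts 1 r))
                 (graph_union (complete_graph_on A\<^sub>1) (complete_graph_on A\<^sub>2)))
              (edgeless_graph_on (comp_verts (t + 1) s))
       else graph_union (complete_graph_on (comp_verts 1 t)) (edgeless_graph_on (comp_verts (t + 1) s))"
  have lim: "graph_seq_converges (\<lambda>m. competition_graph m D) ?H"
    using competition_graphs_converge_split competition_graphs_converge_complete
    unfolding assms(12,13) by simp
  \<comment> \<open>Since \<open>?H\<close> is itself a competition graph, it inherits
    well-formedness from there, with no inspection of its two cases.\<close>
  then obtain m where m: "competition_graph m D = ?H"
    unfolding graph_seq_converges_def eventually_sequentially by blast
  have "wf_digraph (with_proj (competition_graph m D))"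
    by unfold_locales (auto simp: competition_graph_def)
  then have iso: "digraph_iso (with_proj ?H) (with_proj ?H)"
    unfolding m by (rule wf_digraph.digraph_iso_refl)
  show ?thesis
    unfolding component_range_def induce_subgraph_verts by (rule exI, rule conjI[OF lim iso])
qed

end
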